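(* Let $a,b>0$ and $v\in(0,1)$. Put $h=\frac{b}{a}$, $r=\min\{v,1-v\}$, $r_1=\min\{2r,1-2r\}$ and $\hat r_1=\min\{2r_1,1-2r_1\}$. (I) If $0<v\le\frac12$, then $$(1-v)a+vb\ \ge\ v(\sqrt a-\sqrt b)^2+r_1(\sqrt[4]{ab}-\sqrt a)^2+\mathrm{K}(\sqrt[4]{h},2)^{\hat r_1}\,a^{1-v}b^v.$$ (II) If $\frac12<v<1$, then $$(1-v)a+vb\ \ge\ (1-v)(\sqrt a-\sqrt b)^2+r_1(\sqrt[4]{ab}-\sqrt b)^2+\mathrm{K}(\sqrt[4]{h},2)^{\hat r_1}\,a^{1-v}b^v.$$
   Context: For $t>0$, $\mathrm{K}(t,2)=\frac{(t+1)^2}{4t}$ denotes the Kantorovich constant. *)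

theory Defs
  imports Complex_Main
begin

text \<open>The Kantorovich constant \<open>K(t,2)\<close>; its second argument is fixed to 2.\<close>

definition kantorovich2 :: "real \<Rightarrow> real" where
  "kantorovich2 t = (t + 1)\<^sup>2 / (4 * t)"

end

(* If v <= 1/2 then (1 - v) a + v b - v (sqrt a - sqrt b)^2 = (1 - 2 v) a + 2 v sqrt (a b), so
   subtracting the quadratic term replaces the pair (a, b) with weight v by the pair (a, sqrt (a b))
   with weight 2 v. Doing this twice leaves the Kantorovich refinement of Young's inequality,
   which in turn is Young's inequality for one endpoint and the midpoint (a + b) / 2. *)
theory Submission
  imports Defs "HOL-Analysis.Convex"
begin

lemma kantorovich2_inverse:
  assumes "t > 0"
  shows "kantorovich2 (1 / t) = kantorovich2 t"
  using assms by (simp add: kantorovich2_def field_simps power2_eq_square)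

text \<open>In this form the constant is the squared ratio of the arithmetic to the geometric mean,
  so its power \<open>v\<close> trades a factor \<open>(a * b) powr v\<close> for a power of the
  midpoint.\<close>

lemma kantorovich2_quotient:
  assumes "a > 0" and "b > 0"
  shows "kantorovich2 (b / a) = ((a + b) / 2)\<^sup>2 / (a * b)"
  using assms by (simp add: kantorovich2_def field_simps power2_eq_square)

lemma kantorovich_young_half:
  fixes a b v :: real
  assumes "a > 0" and "b > 0" and "0 \<le> v" and "v \<le> 1 / 2"
  shows "kantorovich2 (b / a) powr v * (a powr (1 - v) * b powr v) \<le> (1 - v) * a + v * b"
proof -
  define m where "m = (a + b) / 2"
  have m: "m > 0"
    using assms by (simp add: m_def)
  have "kantorovich2 (b / a) powr v = m powr (2 * v) / (a powr v * b powr v)"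
    using assms m powr_powr[of m 2 v]
    by (simp add: kantorovich2_quotient m_def[symmetric] powr_divide powr_mult powr_numeral)
  moreover have "a powr (1 - v) = a powr (1 - 2 * v) * a powr v"
    by (simp add: powr_add[symmetric])
  ultimately have "kantorovich2 (b / a) powr v * (a powr (1 - v) * b powr v)
      = a powr (1 - 2 * v) * m powr (2 * v)"
    using assms by simp
  \<comment> \<open>The hypothesis \<open>v \<le> 1 / 2\<close> makes \<open>1 - 2 * v\<close> and
    \<open>2 * v\<close> nonnegative weights with sum 1.\<close>
  also have "\<dots> \<le> (1 - 2 * v) * a + (2 * v) * m"
    using assms m by (intro Youngs_inequality_0) auto
  also have "\<dots> = (1 - v) * a + v * b"
    by (simp add: m_def field_simps)
  finally show ?thesis .
qed

lemma kantorovich_young: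
  fixes a b v :: real
  assumes "a > 0" and "b > 0" and "0 \<le> v" and "v \<le> 1"
  shows "kantorovich2 (b / a) powr min v (1 - v) * (a powr (1 - v) * b powr v)
    \<le> (1 - v) * a + v * b"
proof (cases "v \<le> 1 / 2")
  case True
  then show ?thesis
    using kantorovich_young_half[of a b v] assms by (simp add: min_def)
next
  case False
  \<comment> \<open>Exchanging \<open>a\<close> with \<open>b\<close> and \<open>v\<close> with
    \<open>1 - v\<close> preserves both means, and it inverts the argument of
    \<open>kantorovich2\<close>, which does not change its value.\<close>
  then show ?thesis
    using kantorovich_young_half[of b a "1 - v"] kantorovich2_inverse[of "b / a"] assms
    by (simp add: min_def mult.commute add.commute)
qed

text \<open>Passing to the pair \<open>a\<close>, \<open>sqrt (a * b)\<close> with doubled weight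
  thus leaves the weighted geometric mean alone; only the arithmetic side and the argument of
  \<open>kantorovich2\<close> change.\<close>

lemma powr_mult_sqrt_mult:
  fixes a b v :: real
  assumes "a > 0" and "b > 0"
  shows "a powr (1 - 2 * v) * sqrt (a * b) powr (2 * v) = a powr (1 - v) * b powr v"
proof -
  have "sqrt (a * b) powr (2 * v) = (a * b) powr v"
    using assms powr_powr[of "sqrt (a * b)" 2 v] by (simp add: powr_numeral)
  then show ?thesis
    using assms by (simp add: powr_mult powr_add[symmetric] flip: mult.assoc)
qed

lemma sub_sqrt_diff_square:
  fixes a b v :: real
  assumes "a > 0" and "b > 0"
  shows "(1 - v) * a + v * b - v * (sqrt a - sqrt b)\<^sup>2 = (1 - 2 * v) * a + (2 * v) * sqrt (a * b)"
  using assms by (simp add: power2_diff real_sqrt_mult algebra_simps)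

text \<open>Each reduction replaces the ratio of the pair by its square root; two reductions produce
  the fourth root of \<open>b / a\<close>.\<close>

lemma sqrt_mult_divide:
  fixes a b :: real
  assumes "a > 0" and "b > 0"
  shows "sqrt (a * b) / a = sqrt (b / a)"
  using assms by (simp add: real_sqrt_mult real_sqrt_divide field_simps)

lemma young_sqrt_kantorovich_half:
  fixes a b v :: real
  assumes "a > 0" and "b > 0" and "0 \<le> v" and "v \<le> 1 / 2"
  shows "v * (sqrt a - sqrt b)\<^sup>2
      + kantorovich2 (sqrt (b / a)) powr min (2 * v) (1 - 2 * v) * (a powr (1 - v) * b powr v)
    \<le> (1 - v) * a + v * b"
  using kantorovich_young[of a "sqrt (a * b)" "2 * v"] sub_sqrt_diff_square[of a b v] assms
  by (simp add: powr_mult_sqrt_mult sqrt_mult_divide)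

text \<open>The full range of \<open>v\<close> is needed because the second reduction uses this
  inequality with weight \<open>2 * v\<close>, which may exceed \<open>1 / 2\<close>.\<close>

lemma young_sqrt_kantorovich:
  fixes a b v :: real
  assumes "a > 0" and "b > 0" and "0 \<le> v" and "v \<le> 1" and r: "r = min v (1 - v)"
  shows "r * (sqrt a - sqrt b)\<^sup>2
      + kantorovich2 (sqrt (b / a)) powr min (2 * r) (1 - 2 * r) * (a powr (1 - v) * b powr v)
    \<le> (1 - v) * a + v * b"
proof (cases "v \<le> 1 / 2")
  case True
  then show ?thesis
    using young_sqrt_kantorovich_half[of a b v] assms by (simp add: min_def)
next
  case False
  then have "r = 1 - v"
    using r by simp
  then show ?thesis
    using False young_sqrt_kantorovich_half[of b a "1 - v"] kantorovich2_inverse[of "sqrt (b / a)"] assms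
    by (simp add: real_sqrt_divide power2_commute[of "sqrt b"] mult.commute add.commute)
qed

lemma root_4_eq_sqrt_sqrt: "root 4 x = sqrt (sqrt x)"
  using real_root_mult_exp[of 2 2 x] by (simp add: sqrt_def)

text \<open>For the pair \<open>a\<close>, \<open>sqrt (a * b)\<close> with weight
  \<open>2 * v\<close>, the smaller weight is \<open>r1\<close>, and the square root of the second
  entry is \<open>root 4 (a * b)\<close>, which gives the second quadratic term.\<close>

lemma young_root4_kantorovich_half:
  fixes a b v :: real
  assumes "a > 0" and "b > 0" and "0 \<le> v" and "v \<le> 1 / 2" and r1: "r1 = min (2 * v) (1 - 2 * v)"
  shows "v * (sqrt a - sqrt b)\<^sup>2 + r1 * (root 4 (a * b) - sqrt a)\<^sup>2
      + kantorovich2 (root 4 (b / a)) powr min (2 * r1) (1 - 2 * r1) * (a powr (1 - v) * b powr v)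
    \<le> (1 - v) * a + v * b"
  using young_sqrt_kantorovich[of a "sqrt (a * b)" "2 * v" r1] sub_sqrt_diff_square[of a b v] assms
  by (simp add: powr_mult_sqrt_mult sqrt_mult_divide root_4_eq_sqrt_sqrt
      power2_commute[of "sqrt (sqrt (a * b))"])

theorem theorem2p1:
  fixes a b v h r r1 r1_hat :: real
  assumes "a > 0" and "b > 0" and "0 < v" and "v < 1"
    and "h = b / a"
    and "r = min v (1 - v)"
    and "r1 = min (2 * r) (1 - 2 * r)"
    and "r1_hat = min (2 * r1) (1 - 2 * r1)"
  shows "(0 < v \<and> v \<le> 1 / 2 \<longrightarrow>
      (1 - v) * a + v * b \<ge>
        v * (sqrt a - sqrt b)\<^sup>2 + r1 * (root 4 (a * b) - sqrt a)\<^sup>2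
        + kantorovich2 (root 4 h) powr r1_hat * (a powr (1 - v) * b powr v))
    \<and> (1 / 2 < v \<and> v < 1 \<longrightarrow>
      (1 - v) * a + v * b \<ge>
        (1 - v) * (sqrt a - sqrt b)\<^sup>2 + r1 * (root 4 (a * b) - sqrt b)\<^sup>2
        + kantorovich2 (root 4 h) powr r1_hat * (a powr (1 - v) * b powr v))"
proof (intro conjI impI)
  assume v: "0 < v \<and> v \<le> 1 / 2"
  then have "r = v"
    using assms by simp
  then show "(1 - v) * a + v * b \<ge>
        v * (sqrt a - sqrt b)\<^sup>2 + r1 * (root 4 (a * b) - sqrt a)\<^sup>2
        + kantorovich2 (root 4 h) powr r1_hat * (a powr (1 - v) * b powr v)"
    using v young_root4_kantorovich_half[of a b v r1] assms by simp
next
  assume v: "1 / 2 < v \<and> v < 1"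
  then have r: "r = 1 - v"
    using assms by simp
  \<comment> \<open>Part (II) is part (I) with \<open>a\<close>, \<open>b\<close> exchanged and
    weight \<open>1 - v\<close>, so the constant first appears at the inverse ratio.\<close>
  have "kantorovich2 (root 4 (a / b)) = kantorovich2 (root 4 h)"
    using kantorovich2_inverse[of "root 4 (b / a)"] assms by (simp add: real_root_divide)
  then show "(1 - v) * a + v * b \<ge>
        (1 - v) * (sqrt a - sqrt b)\<^sup>2 + r1 * (root 4 (a * b) - sqrt b)\<^sup>2
        + kantorovich2 (root 4 h) powr r1_hat * (a powr (1 - v) * b powr v)"
    using v r young_root4_kantorovich_half[of b a "1 - v" r1] assms(1-4,7,8)
    by (simp add: power2_commute[of "sqrt b" "sqrt a"] mult.commute add.commute)
qed

end
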